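(* For every integer $m>0$, $$(2m)!\, A_{2m+1} = h(-2m) - \zeta(1-2m) = \frac{1}{2} B_{2m}\left(1 + \frac{1}{2m}\right),$$ where $B_{2m}$ are the Bernoulli numbers, $\zeta$ is the Riemann zeta function, $A_n$ is the convolution $$A_n = \sum_{\substack{k+j=n\\ k\ge 1,\ j\ge 0}} \frac{B(k)}{k!\,k}\,\frac{B(j)}{j!},$$ and $h(-2m)$ is the value at $-2m$ of the analytic continuation of $h(s)=\sum_{n=1}^\infty H_n n^{-s}$.
   Context: $H_n = 1+\frac12+\cdots+\frac1n$ are the harmonic numbers. The series $h(s)=\sum_{n\ge1}H_n n^{-s}$ converges for $\operatorname{Re} s>1$, and $h$ also denotes its meromorphic continuation to $\mathbb{C}$, which is regular at the negative even integers. $B_m$ are the Bernoulli numbers with $\frac{z}{e^z-1}=\sum_{m\ge0}B_m\frac{z^m}{m!}$ (so $B_1=-\frac12$), and $B(m)=B_m$ for $m\ne1$, while $B(1)=-B_1=\frac12$. Equivalently, $\frac{ze^z}{e^z-1}\log\left(\frac{e^z-1}{z}\right)=\sum_{n\ge1}A_nz^n$ near $z=0$. *)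

theory Defs
  imports "HOL-Complex_Analysis.Complex_Analysis"
begin

text \<open>
  The convention is \<open>z / (e\<^sup>z - 1) = (\<Sum>m. B\<^sub>m z\<^sup>m / m!)\<close>, so \<open>bernoulli 1 = -1/2\<close>.
  The quotient of formal power series is well-behaved although \<open>e\<^sup>z - 1\<close> is not a unit,
  since division cancels the common factor \<open>z\<close>.
\<close>
definition bernoulli :: "nat \<Rightarrow> real" where
  "bernoulli m = fact m * fps_nth (fps_X / (fps_exp 1 - 1)) m"

lemma bernoulli_generating_function:
  "Abs_fps (\<lambda>m. bernoulli m / fact m) * (fps_exp 1 - 1) = fps_X"
proof -
  have "fps_nth (fps_exp 1 - 1 :: real fps) 1 \<noteq> 0"
    by simp
  hence nz: "fps_exp 1 - 1 \<noteq> (0 :: real fps)"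
    by force
  have "subdegree (fps_exp 1 - 1 :: real fps) = 1"
    by (rule subdegreeI) auto
  hence dvd: "(fps_exp 1 - 1 :: real fps) dvd fps_X"
    using nz by (simp add: fps_dvd_iff)
  have "Abs_fps (\<lambda>m. bernoulli m / fact m) = fps_X / (fps_exp 1 - 1)"
    by (simp add: bernoulli_def fps_eq_iff)
  thus ?thesis
    using dvd by simp
qed

text \<open>The variant \<open>B(m)\<close>, with \<open>B(1) = 1/2\<close>.\<close>
definition bernoulli_plus :: "nat \<Rightarrow> real" where
  "bernoulli_plus m = (if m = 1 then - bernoulli 1 else bernoulli m)"

text \<open>The index \<open>j\<close> of the convolution is \<open>n - k\<close>.\<close>
definition bernoulli_conv :: "nat \<Rightarrow> real" where
  "bernoulli_conv n =
     (\<Sum>k=1..n. bernoulli_plus k / (fact k * real k) * (bernoulli_plus (n - k) / fact (n - k)))"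

text \<open>
  The meromorphic continuation of \<open>f\<close> from \<open>A\<close> to the whole plane. Requiring
  \<open>nicely_meromorphic_on\<close> removes all removable singularities and fixes the value 0 at poles,
  so that there is at most one such function (for nonempty open \<open>A\<close>).
\<close>
definition meromorphic_continuation ::
    "complex set \<Rightarrow> (complex \<Rightarrow> complex) \<Rightarrow> complex \<Rightarrow> complex" where
  "meromorphic_continuation A f =
     (THE g. g nicely_meromorphic_on UNIV \<and> (\<forall>s\<in>A. g s = f s))"

lemma meromorphic_continuation_unique:
  assumes f: "f nicely_meromorphic_on UNIV" and g: "g nicely_meromorphic_on UNIV"
    and A: "open A" "A \<noteq> {}" and eq: "\<And>s. s \<in> A \<Longrightarrow> f s = g s"
  shows "f = g"
proof
  fix z
  define d where "d = remove_sings (\<lambda>s. f s - g s)"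
  have mero: "(\<lambda>s. f s - g s) meromorphic_on UNIV"
    using f g by (auto simp: nicely_meromorphic_on_def intro!: meromorphic_intros)
  have d: "d nicely_meromorphic_on UNIV"
    unfolding d_def by (rule remove_sings_nicely_meromorphic[OF mero])
  have dA: "d s = 0" if "s \<in> A" for s
  proof -
    have "\<forall>\<^sub>F w in at s. f w - g w = 0"
      using A(1) that eq by (auto simp: eventually_at_topological)
    hence "(\<lambda>w. f w - g w) \<midarrow>s\<rightarrow> 0"
      by (rule tendsto_eventually)
    thus ?thesis
      unfolding d_def by (rule remove_sings_eqI)
  qed
  have "d constant_on UNIV"
    by (rule constant_on_extend_nicely_meromorphic_on[OF d _ A(1)])
       (use A dA in \<open>auto simp: constant_on_def\<close>)
  then obtain c where c: "\<And>s. d s = c"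
    by (auto simp: constant_on_def)
  have "c = 0"
    using A(2) dA c by auto
  have ev: "\<forall>\<^sub>F w in at z. f w = g w"
  proof -
    have "\<forall>\<^sub>F w in at z. d w = f w - g w"
      unfolding d_def
      by (rule eventually_remove_sings_eq_at[OF meromorphic_on_isolated_singularity])
         (rule meromorphic_on_subset[OF mero], simp)
    thus ?thesis
      by eventually_elim (use c \<open>c = 0\<close> in auto)
  qed
  have pole: "is_pole f z \<longleftrightarrow> is_pole g z"
    using ev by (intro is_pole_cong) auto
  show "f z = g z"
  proof (cases "is_pole f z")
    case True
    thus ?thesis
      using pole is_pole_zero_at_nicely_mero[OF f] is_pole_zero_at_nicely_mero[OF g] by simp
  next
    case False
    hence "f \<midarrow>z\<rightarrow> f z" "g \<midarrow>z\<rightarrow> g z"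
      using f g pole by (auto simp: nicely_meromorphic_on_def)
    moreover from this(1) have "g \<midarrow>z\<rightarrow> f z"
      using ev by (rule Lim_transform_eventually)
    ultimately show ?thesis
      using LIM_unique by blast
  qed
qed

definition riemann_zeta :: "complex \<Rightarrow> complex" where
  "riemann_zeta =
     meromorphic_continuation {s. Re s > 1} (\<lambda>s. \<Sum>n. of_nat (Suc n) powr (- s))"

definition harmonic_zeta :: "complex \<Rightarrow> complex" where
  "harmonic_zeta =
     meromorphic_continuation {s. Re s > 1} (\<lambda>s. \<Sum>n. harm (Suc n) * of_nat (Suc n) powr (- s))"

end

theory Submission
  imports Defs
begin

text \<open>
  Let \<open>c\<^sub>j = B(j) / j!\<close> and let \<open>(x)\<^sub>j\<close> be the rising factorial. By Taylor's formula and the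
  recursion for the Bernoulli numbers, the remainder
  \[ q_N(n, s) = (s - 1) n^{-s} - \sum_{j \le N} c_j (s - 1)_j \bigl(n^{1-s-j} - (n+1)^{1-s-j}\bigr) \]
  is \<open>O(|(s-1)\<^bsub>N+2\<^esub>| n\<^bsup>-Re s-N-1\<^esup>)\<close>. For weights \<open>a\<^sub>n\<close> of subpolynomial growth with
  \<open>a\<^sub>0 = 0\<close> and \<open>G(s) = \<Sum> (a\<^sub>n - a\<^bsub>n-1\<^esub>) n\<^bsup>-s\<^esup>\<close>, Abel summation turns this into
  \[ (s - 1) \sum_n a_n n^{-s} = \sum_{j \le N} c_j (s - 1)_j G(s - 1 + j) + \sum_n a_n q_N(n, s), \]
  whose right-hand side makes sense for \<open>Re s > -N\<close>. Weights \<open>1\<close> (with \<open>G = 1\<close>) continue \<open>\<zeta>\<close>,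
  and weights \<open>H\<^sub>n\<close> (with \<open>G(s) = \<zeta>(s + 1)\<close>) continue \<open>h\<close>. At \<open>s = -k\<close> with \<open>k \<le> N\<close> the factor
  \<open>(s-1)\<^bsub>N+2\<^esub>\<close>, hence the remainder, vanishes, and both values are finite Bernoulli sums.
  Since \<open>\<zeta>\<close> vanishes at the negative even integers and \<open>B\<^sub>j = 0\<close> for odd \<open>j \<ge> 3\<close>, all that is
  left is \<open>h(-2m) = (\<zeta>(1-2m) + B\<^bsub>2m\<^esub>) / 2\<close>; likewise only \<open>k = 1\<close> and \<open>k = 2m\<close> survive in
  \<open>A\<^bsub>2m+1\<^esub>\<close>.
\<close>

section \<open>Bernoulli numbers\<close>

text \<open>Coefficient of \<open>X^l\<close> in the generating identity; the term
  \<open>j = l\<close> drops out because \<open>e^X - 1\<close> has no constant term.\<close>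

lemma sum_bernoulli_eq:
  "(\<Sum>j<l. bernoulli j / (fact j * fact (l - j))) = (if l = 1 then 1 else 0)"
proof -
  have "(\<Sum>j\<le>l. bernoulli j / fact j * fps_nth (fps_exp 1 - 1 :: real fps) (l - j)) =
          fps_nth fps_X l"
    by (subst bernoulli_generating_function [symmetric])
       (simp only: fps_mult_nth Abs_fps_inverse fps_nth_Abs_fps atLeast0AtMost)
  also have "(\<Sum>j\<le>l. bernoulli j / fact j * fps_nth (fps_exp 1 - 1 :: real fps) (l - j)) =
      (\<Sum>j<l. bernoulli j / fact j * fps_nth (fps_exp 1 - 1 :: real fps) (l - j))"
    by (intro sum.mono_neutral_right) auto
  also have "\<dots> = (\<Sum>j<l. bernoulli j / (fact j * fact (l - j)))"
    by (intro sum.cong) (auto simp: mult_ac)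
  finally show ?thesis by simp
qed

lemma bernoulli_0: "bernoulli 0 = 1"
  using sum_bernoulli_eq [of 1] by simp

lemma bernoulli_1: "bernoulli (Suc 0) = - 1 / 2"
  using sum_bernoulli_eq [of 2] by (simp add: bernoulli_0 numeral_2_eq_2 lessThan_Suc field_simps)

lemma bernoulli_plus_0: "bernoulli_plus 0 = 1"
  by (simp add: bernoulli_plus_def bernoulli_0)

text \<open>With \<open>F = X / (e\<^sup>X - 1)\<close>, the claim is \<open>F(-X) = F(X) + X\<close>.\<close>
lemma bernoulli_odd:
  assumes "odd k" "k \<noteq> 1"
  shows "bernoulli k = 0"
proof -
  define E :: "real fps" where "E = fps_exp 1"
  define F :: "real fps" where "F = Abs_fps (\<lambda>m. bernoulli m / fact m)"
  define F' :: "real fps" where "F' = F oo (- fps_X)"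
  have F: "F * (E - 1) = fps_X"
    unfolding E_def F_def by (rule bernoulli_generating_function)
  have "(F * (E - 1)) oo (- fps_X) = F' * ((E oo (- fps_X)) - 1)"
    by (simp add: fps_compose_mult_distrib fps_compose_sub_distrib F'_def)
  moreover have "E oo (- fps_X) = fps_exp (- 1)"
    by (simp add: E_def)
  ultimately have "F' * (fps_exp (- 1) - 1) = - fps_X"
    by (simp add: F)
  \<comment> \<open>Multiplying by \<open>e^X\<close> turns \<open>e^(-X) - 1\<close> into
    \<open>1 - e^X\<close>, so that \<open>F'\<close> and \<open>F\<close> carry the same factor
    \<open>E - 1\<close>, which can be cancelled.\<close>
  hence "F' * (fps_exp (- 1) - 1) * E = - fps_X * E"
    by simp
  moreover have "fps_exp (- 1) * E = 1"
    by (simp add: E_def fps_exp_add_mult [symmetric])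
  ultimately have "F' * (E - 1) = fps_X * E"
    by (simp add: algebra_simps) (metis add.commute diff_add_cancel mult.commute mult.left_commute mult.right_neutral)
  also have "\<dots> = (F + fps_X) * (E - 1)"
    using F by (simp add: algebra_simps)
  finally have "F' * (E - 1) = (F + fps_X) * (E - 1)" .
  moreover have "E - 1 \<noteq> 0"
    using F by force
  ultimately have "F' = F + fps_X"
    by simp
  \<comment> \<open>For odd \<open>k \<noteq> 1\<close> the coefficients read
    \<open>- F_k = F_k\<close>.\<close>
  hence "fps_nth F' k = fps_nth (F + fps_X) k"
    by simp
  moreover have "fps_nth F' k = (- 1) ^ k * fps_nth F k"
    unfolding F'_def by (simp add: fps_compose_uminus')
  ultimately show ?thesis
    using assms by (simp add: F_def)
qed

text \<open>The sign matters only at odd \<open>j\<close>; there both sides vanish, except at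
  \<open>j = 1\<close>, where it undoes the sign change in \<open>B(1)\<close>.\<close>

lemma bernoulli_plus_minus: "(- 1) ^ j * bernoulli_plus j = bernoulli j"
  using bernoulli_odd [of j] by (cases "even j") (auto simp: bernoulli_plus_def)

section \<open>The convolution at odd index\<close>

lemma bernoulli_conv_odd:
  assumes "m > 0"
  shows "fact (2 * m) * bernoulli_conv (2 * m + 1) = 1 / 2 * bernoulli (2 * m) * (1 + 1 / (2 * real m))"
proof -
  define t where "t k = bernoulli_plus k / (fact k * real k) *
    (bernoulli_plus (2 * m + 1 - k) / fact (2 * m + 1 - k))" for k
  \<comment> \<open>The indices \<open>k\<close> and \<open>2 * m + 1 - k\<close> have opposite
    parity. The odd one kills the term unless it equals 1, that is, unless \<open>k = 1\<close> or
    \<open>k = 2 * m\<close>.\<close>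
  have "t k = 0" if "k \<in> {1..2*m+1} - {1, 2*m}" for k
  proof (cases "even k")
    case True
    hence "odd (2 * m + 1 - k)" "2 * m + 1 - k \<noteq> 1"
      using that by auto
    thus ?thesis
      by (simp add: t_def bernoulli_plus_def bernoulli_odd)
  next
    case False
    thus ?thesis
      using that by (simp add: t_def bernoulli_plus_def bernoulli_odd)
  qed
  hence "bernoulli_conv (2 * m + 1) = (\<Sum>k\<in>{1, 2*m}. t k)"
    unfolding bernoulli_conv_def t_def [symmetric]
    using assms by (intro sum.mono_neutral_right) auto
  also have "\<dots> = t 1 + t (2 * m)"
    by simp
  also have "t 1 = 1 / 2 * bernoulli (2 * m) / fact (2 * m)"
    using assms by (auto simp: t_def bernoulli_plus_def bernoulli_1)
  also have "t (2 * m) = bernoulli (2 * m) / (fact (2 * m) * (2 * m)) * (1 / 2)"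
    using assms by (auto simp: t_def bernoulli_plus_def bernoulli_1)
  finally show ?thesis
    using assms by (simp add: field_simps)
qed

section \<open>The Euler--Maclaurin remainder\<close>

definition euler_maclaurin_coeff :: "nat \<Rightarrow> complex" where
  "euler_maclaurin_coeff j = of_real (bernoulli_plus j / fact j)"

definition euler_maclaurin_remainder :: "nat \<Rightarrow> nat \<Rightarrow> complex \<Rightarrow> complex" where
  "euler_maclaurin_remainder N n s = (s - 1) * of_nat n powr (- s) -
     (\<Sum>j\<le>N. euler_maclaurin_coeff j * pochhammer (s - 1) j *
        (of_nat n powr (1 - s - of_nat j) - of_nat (Suc n) powr (1 - s - of_nat j)))"

text \<open>Taylor's theorem for \<open>z powr (- w)\<close> on the segment from \<open>x\<close> to
  \<open>x + 1\<close>, which lies on the positive real axis and so avoids the branch cut. The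
  hypothesis on \<open>Re w\<close> makes the modulus of
  \<open>z powr (- w - of_nat (Suc K))\<close> largest at the left end \<open>x\<close>.\<close>

lemma powr_taylor_bound:
  fixes w :: complex and x :: real
  assumes x: "x > 0" and Re: "Re w + real (Suc K) \<ge> 0"
  shows "cmod (of_real (x + 1) powr (- w) -
            (\<Sum>i\<le>K. (- 1) ^ i * pochhammer w i / fact i * of_real x powr (- w - of_nat i)))
         \<le> cmod (pochhammer w (Suc K)) * x powr (- Re w - real (Suc K))"
proof -
  define f where "f i z = (- 1) ^ i * pochhammer w i * z powr (- w - of_nat i)" for i and z :: complex
  define S where "S = closed_segment (of_real x) (of_real (x + 1) :: complex)"
  have S: "z \<in> \<real> \<and> Re z \<ge> x" if z: "z \<in> S" for z
  proof -
    from z obtain u where u: "0 \<le> u" "u \<le> 1" "z = (1 - u) *\<^sub>R of_real x + u *\<^sub>R of_real (x + 1)"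
      by (auto simp: S_def closed_segment_def)
    hence "z = of_real (x + u)"
      by (simp add: scaleR_conv_of_real algebra_simps)
    thus ?thesis
      using u by auto
  qed
  have "cmod (f 0 (of_real (x + 1)) -
          (\<Sum>i\<le>K. f i (of_real x) * (of_real (x + 1) - of_real x) ^ i / fact i)) \<le>
        cmod (pochhammer w (Suc K)) * x powr (- Re w - real (Suc K)) *
        cmod (of_real (x + 1) - of_real x) ^ Suc K / fact K"
  proof (rule complex_Taylor [where S = S])
    show "(f i has_field_derivative f (Suc i) z) (at z within S)" if "z \<in> S" for i z
    proof -
      have "Re z > 0"
        using S [OF that] x by auto
      hence "z \<notin> \<real>\<^sub>\<le>\<^sub>0"
        by (auto simp: complex_nonpos_Reals_iff)
      thus ?thesis unfolding f_def
        by (auto intro!: derivative_eq_intros simp: pochhammer_Suc algebra_simps)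
    qed
    show "cmod (f (Suc K) z) \<le> cmod (pochhammer w (Suc K)) * x powr (- Re w - real (Suc K))"
      if "z \<in> S" for z
    proof -
      have "cmod (z powr (- w - of_nat (Suc K))) = Re z powr (- Re w - real (Suc K))"
        using S [OF that] x by (subst norm_powr_real_powr) auto
      also have "\<dots> \<le> x powr (- Re w - real (Suc K))"
        using S [OF that] x Re by (intro powr_mono2') auto
      finally show ?thesis
        unfolding f_def norm_mult by (simp add: norm_power mult_left_mono del: of_nat_Suc)
    qed
  qed (auto simp: S_def)
  also have "f 0 (of_real (x + 1)) = of_real (x + 1) powr (- w)"
    by (simp add: f_def)
  also have "(\<Sum>i\<le>K. f i (of_real x) * (of_real (x + 1) - of_real x) ^ i / fact i) =
    (\<Sum>i\<le>K. (- 1) ^ i * pochhammer w i / fact i * of_real x powr (- w - of_nat i))"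
    by (simp add: f_def mult_ac)
  \<comment> \<open>The step has length 1, and the factor \<open>1 / K!\<close> is bounded by
    1.\<close>
  also have "cmod (pochhammer w (Suc K)) * x powr (- Re w - real (Suc K)) *
        cmod (of_real (x + 1) - of_real x) ^ Suc K / fact K \<le>
      cmod (pochhammer w (Suc K)) * x powr (- Re w - real (Suc K)) / 1"
    by (simp del: power_Suc of_nat_Suc, intro divide_left_mono [where b = 1, simplified])
       auto
  finally show ?thesis by simp
qed

text \<open>The sign \<open>(-1)^(l-j) = (-1)^l (-1)^j\<close> turns \<open>B(j)\<close> into
  \<open>B_j\<close>, which reduces the sum to the Bernoulli recursion.\<close>

lemma sum_euler_maclaurin_coeff:
  "(\<Sum>j<l. euler_maclaurin_coeff j * (- 1) ^ (l - j) / fact (l - j)) = (if l = 1 then - 1 else 0)"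
proof -
  have "(\<Sum>j<l. euler_maclaurin_coeff j * (- 1) ^ (l - j) / fact (l - j)) =
        (\<Sum>j<l. (- 1) ^ l * of_real (bernoulli j / (fact j * fact (l - j))))"
  proof (intro sum.cong refl)
    fix j assume "j \<in> {..<l}"
    hence "(- 1 :: complex) ^ (l - j) = (- 1) ^ l * (- 1) ^ j"
      by (metis lessThan_iff less_imp_le minus_one_power_iff even_diff_nat even_add mult.commute
            mult_minus_left mult_1 minus_minus linorder_not_less)
    thus "euler_maclaurin_coeff j * (- 1) ^ (l - j) / fact (l - j) =
          (- 1) ^ l * of_real (bernoulli j / (fact j * fact (l - j)))"
      by (simp add: euler_maclaurin_coeff_def bernoulli_plus_minus [of j, symmetric])
  qed
  also have "\<dots> = (- 1) ^ l * of_real (\<Sum>j<l. bernoulli j / (fact j * fact (l - j)))"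
    by (simp add: sum_distrib_left)
  finally show ?thesis
    by (simp add: sum_bernoulli_eq)
qed

text \<open>The remainder is a combination of Taylor remainders. The orders \<open>N + 1 - j\<close>
  are chosen so that all expansions stop at the same power of \<open>n\<close>; collected by powers,
  the terms with \<open>i \<ge> 1\<close> cancel except for \<open>(s - 1) n^(-s)\<close>.\<close>

lemma euler_maclaurin_remainder_eq:
  "euler_maclaurin_remainder N n s =
     (\<Sum>j\<le>N. euler_maclaurin_coeff j * pochhammer (s - 1) j *
       (of_nat (Suc n) powr (- (s - 1 + of_nat j)) -
        (\<Sum>i\<le>N + 1 - j. (- 1) ^ i * pochhammer (s - 1 + of_nat j) i / fact i *
            of_nat n powr (- (s - 1 + of_nat j) - of_nat i))))"
proof -
  define p where "p l = of_nat n powr (1 - s - of_nat l)" for l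
  define c where "c = euler_maclaurin_coeff"
  \<comment> \<open>Rising factorials concatenate: \<open>(s-1)_j (s-1+j)_i = (s-1)_(j+i)\<close>.
    Hence the expansion can be indexed by \<open>l = j + i\<close>, with the term
    \<open>l = j\<close> split off.\<close>
  have inner: "c j * pochhammer (s - 1) j *
          (\<Sum>i\<le>N + 1 - j. (- 1) ^ i * pochhammer (s - 1 + of_nat j) i / fact i *
            of_nat n powr (- (s - 1 + of_nat j) - of_nat i)) =
        c j * pochhammer (s - 1) j * p j +
        (\<Sum>l\<in>{j<..N + 1}. pochhammer (s - 1) l * p l * (c j * (- 1) ^ (l - j) / fact (l - j)))"
    (is "?L = _") if "j \<le> N" for j
  proof -
    have "?L = (\<Sum>i\<le>N + 1 - j. pochhammer (s - 1) (j + i) * p (j + i) * (c j * (- 1) ^ i / fact i))"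
      unfolding sum_distrib_left pochhammer_product' p_def
      by (intro sum.cong refl) (simp add: diff_diff_add diff_add_eq mult_ac add_ac)
    also have "\<dots> = (\<Sum>l\<in>{j..N + 1}. pochhammer (s - 1) l * p l * (c j * (- 1) ^ (l - j) / fact (l - j)))"
      using that by (intro sum.reindex_bij_witness [of _ "\<lambda>l. l - j" "\<lambda>i. j + i"]) auto
    also have "{j..N + 1} = insert j {j<..N + 1}"
      using that by auto
    finally show ?thesis
      by (simp add: mult_ac)
  qed
  \<comment> \<open>Exchanging the sums over the triangle \<open>j < l \<le> N + 1\<close> isolates
    the inner sum over \<open>j\<close>, which is zero unless \<open>l = 1\<close>.\<close>
  have "(\<Sum>j\<le>N. \<Sum>l\<in>{j<..N + 1}. pochhammer (s - 1) l * p l * (c j * (- 1) ^ (l - j) / fact (l - j))) =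
        (\<Sum>l\<in>{1..N + 1}. \<Sum>j<l. pochhammer (s - 1) l * p l * (c j * (- 1) ^ (l - j) / fact (l - j)))"
    by (subst (1 2) sum.Sigma, simp, simp, simp, simp,
        rule sum.reindex_bij_witness [of _ "\<lambda>(l, j). (j, l)" "\<lambda>(j, l). (l, j)"]) auto
  also have "\<dots> = (\<Sum>l\<in>{1..N + 1}. pochhammer (s - 1) l * p l * (if l = 1 then - 1 else 0))"
    by (simp only: sum_distrib_left [symmetric] c_def sum_euler_maclaurin_coeff)
  also have "\<dots> = - ((s - 1) * of_nat n powr (- s))"
    by (simp add: if_distrib p_def cong: if_cong)
  finally have double: "(\<Sum>j\<le>N. \<Sum>l\<in>{j<..N + 1}.
      pochhammer (s - 1) l * p l * (c j * (- 1) ^ (l - j) / fact (l - j))) = \<dots>" .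
  have "(\<Sum>j\<le>N. c j * pochhammer (s - 1) j *
       (of_nat (Suc n) powr (- (s - 1 + of_nat j)) -
        (\<Sum>i\<le>N + 1 - j. (- 1) ^ i * pochhammer (s - 1 + of_nat j) i / fact i *
            of_nat n powr (- (s - 1 + of_nat j) - of_nat i)))) =
     (\<Sum>j\<le>N. c j * pochhammer (s - 1) j * of_nat (Suc n) powr (- (s - 1 + of_nat j)) -
       (c j * pochhammer (s - 1) j * p j +
       (\<Sum>l\<in>{j<..N + 1}. pochhammer (s - 1) l * p l * (c j * (- 1) ^ (l - j) / fact (l - j)))))"
    by (intro sum.cong refl, subst right_diff_distrib, subst inner) (auto simp del: of_nat_Suc)
  also have "\<dots> = (\<Sum>j\<le>N. c j * pochhammer (s - 1) j * of_nat (Suc n) powr (- (s - 1 + of_nat j))) -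
       (\<Sum>j\<le>N. c j * pochhammer (s - 1) j * p j) + (s - 1) * of_nat n powr (- s)"
    by (simp only: sum_subtractf sum.distrib double) simp
  also have "\<dots> = euler_maclaurin_remainder N n s"
    by (simp add: euler_maclaurin_remainder_def c_def p_def algebra_simps sum_subtractf del: of_nat_Suc)
  finally show ?thesis
    by (simp add: c_def)
qed

text \<open>For each \<open>j\<close> the Taylor bound at \<open>w = s - 1 + j\<close> completes
  \<open>(s-1)_j\<close> to \<open>(s-1)_(N+2)\<close>, and the exponent of \<open>n\<close> comes
  out independent of \<open>j\<close>, as does the condition on the real part.\<close>

lemma euler_maclaurin_remainder_bound:
  assumes n: "n > 0" and Re: "Re s + real N + 1 \<ge> 0"
  shows "cmod (euler_maclaurin_remainder N n s) \<le>
    (\<Sum>j\<le>N. cmod (euler_maclaurin_coeff j)) * cmod (pochhammer (s - 1) (N + 2)) *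
    real n powr (- Re s - real N - 1)"
  unfolding euler_maclaurin_remainder_eq sum_distrib_right
proof (rule sum_norm_le)
  fix j assume "j \<in> {..N}"
  hence j: "j \<le> N" by simp
  define w where "w = s - 1 + of_nat j"
  define D where "D = of_nat (Suc n) powr (- w) -
    (\<Sum>i\<le>N + 1 - j. (- 1) ^ i * pochhammer w i / fact i * of_nat n powr (- w - of_nat i))"
  have "cmod D \<le> cmod (pochhammer w (Suc (N + 1 - j))) * real n powr (- Re w - real (Suc (N + 1 - j)))"
    using powr_taylor_bound [of "real n" w "N + 1 - j"] n Re j
    by (simp add: D_def w_def of_nat_diff add.commute)
  also have "- Re w - real (Suc (N + 1 - j)) = - Re s - real N - 1"
    using j by (simp add: w_def of_nat_diff)
  finally have "cmod (euler_maclaurin_coeff j * pochhammer (s - 1) j * D) \<le>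
      cmod (euler_maclaurin_coeff j) * cmod (pochhammer (s - 1) j) *
      (cmod (pochhammer w (Suc (N + 1 - j))) * real n powr (- Re s - real N - 1))"
    unfolding norm_mult by (intro mult_left_mono) auto
  also have "\<dots> = cmod (euler_maclaurin_coeff j) * cmod (pochhammer (s - 1) j * pochhammer w (Suc (N + 1 - j))) *
      real n powr (- Re s - real N - 1)"
    by (simp add: norm_mult mult_ac)
  also have "pochhammer (s - 1) j * pochhammer w (Suc (N + 1 - j)) = pochhammer (s - 1) (N + 2)"
    using j pochhammer_product [of j "N + 2" "s - 1"] by (simp add: w_def Suc_diff_le)
  finally show "cmod (euler_maclaurin_coeff j * pochhammer (s - 1) j *
       (of_nat (Suc n) powr (- (s - 1 + of_nat j)) -
        (\<Sum>i\<le>N + 1 - j. (- 1) ^ i * pochhammer (s - 1 + of_nat j) i / fact i *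
            of_nat n powr (- (s - 1 + of_nat j) - of_nat i)))) \<le>
    cmod (euler_maclaurin_coeff j) * cmod (pochhammer (s - 1) (N + 2)) * real n powr (- Re s - real N - 1)"
    unfolding D_def w_def .
qed

lemma euler_maclaurin_remainder_eq_0:
  assumes "n > 0" "k \<le> N"
  shows "euler_maclaurin_remainder N n (- of_nat k) = 0"
proof -
  \<comment> \<open>The factor \<open>- k - 1 + Suc k\<close> is zero, and \<open>k \<le> N\<close>
    puts it among the \<open>N + 2\<close> factors.\<close>
  have "pochhammer (- of_nat k - 1 :: complex) (N + 2) = 0"
    using assms by (auto simp: pochhammer_eq_0_iff intro: exI [of _ "Suc k"])
  thus ?thesis
    using euler_maclaurin_remainder_bound [of n "- of_nat k" N] assms by simp
qed

lemma euler_maclaurin_remainder_Suc: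
  "euler_maclaurin_remainder (Suc N) n s = euler_maclaurin_remainder N n s -
     euler_maclaurin_coeff (Suc N) * pochhammer (s - 1) (Suc N) *
       (of_nat n powr (- (s - 1 + of_nat (Suc N))) - of_nat (Suc n) powr (- (s - 1 + of_nat (Suc N))))"
  by (simp add: euler_maclaurin_remainder_def algebra_simps del: of_nat_Suc)

lemma euler_maclaurin_coeff_0: "euler_maclaurin_coeff 0 = 1"
  by (simp add: euler_maclaurin_coeff_def bernoulli_plus_0)

text \<open>Here \<open>(-k)_j = (-1)^j k! / (k-j)!\<close>, and the sign turns \<open>B(j)\<close>
  back into \<open>B_j\<close>.\<close>

lemma euler_maclaurin_coeff_pochhammer:
  assumes "j \<le> k"
  shows "euler_maclaurin_coeff j * pochhammer (- of_nat k) j =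
         of_real (fact k * (bernoulli j / (fact j * fact (k - j))))"
proof -
  have "pochhammer (- of_nat k :: complex) j = (- 1) ^ j * (fact k / fact (k - j))"
    using assms
    using pochhammer_product [of "k - j" k "1 :: complex"]
    by (simp add: pochhammer_minus pochhammer_fact [symmetric] of_nat_diff algebra_simps)
  thus ?thesis
    by (simp add: euler_maclaurin_coeff_def bernoulli_plus_minus [of j, symmetric] mult_ac)
qed

section \<open>Continuation by Abel summation\<close>

lemma pochhammer_analytic: "(\<lambda>z. pochhammer (z - 1) j) analytic_on A" for A :: "complex set"
  by (rule analytic_on_subset [of _ UNIV])
     (auto simp: analytic_on_open intro!: holomorphic_intros)

text \<open>\<open>a_0\<close> removes the lower boundary term of the summation by parts.
  \<open>a_bound\<close> costs an arbitrarily small power of \<open>n\<close>, so the half-planes of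
  convergence are those of constant weights. Analyticity of \<open>G\<close> serves the original
  half-plane, meromorphy the continuation.\<close>

locale dirichlet_abel =
  fixes a :: "nat \<Rightarrow> complex" and G :: "complex \<Rightarrow> complex"
  assumes a_0: "a 0 = 0"
    and a_bound: "\<And>\<epsilon>. \<epsilon> > 0 \<Longrightarrow> \<exists>C\<ge>0. \<forall>n. cmod (a n) \<le> C * real n powr \<epsilon>"
    and G_sums: "\<And>s. Re s > 0 \<Longrightarrow> (\<lambda>n. (a (Suc n) - a n) * of_nat (Suc n) powr (- s)) sums G s"
    and G_analytic: "G analytic_on {s. Re s > 0}"
    and G_meromorphic: "G meromorphic_on UNIV"
begin

section \<open>Convergence and summation by parts\<close>

lemma norm_summable:
  assumes "Re s > 1"
  shows "summable (\<lambda>n. cmod (a (Suc n) * of_nat (Suc n) powr (- s)))"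
proof -
  \<comment> \<open>Half of the excess of \<open>Re s\<close> over 1 pays for the growth of
    \<open>a\<close>: \<open>\<epsilon> - Re s = - 1 - \<epsilon>\<close>.\<close>
  define \<epsilon> where "\<epsilon> = (Re s - 1) / 2"
  have \<epsilon>: "\<epsilon> > 0"
    using assms by (simp add: \<epsilon>_def)
  obtain C where C: "C \<ge> 0" "\<And>n. cmod (a n) \<le> C * real n powr \<epsilon>"
    using a_bound [OF \<epsilon>] by blast
  have "summable (\<lambda>n. real n powr (- 1 - \<epsilon>))"
    using \<epsilon> by (subst summable_real_powr_iff) auto
  hence "summable (\<lambda>n. real (Suc n) powr (- 1 - \<epsilon>))"
    by (subst summable_Suc_iff)
  hence "summable (\<lambda>n. C * real (Suc n) powr (- 1 - \<epsilon>))"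
    by (rule summable_mult)
  moreover have "cmod (a (Suc n) * of_nat (Suc n) powr (- s)) \<le> C * real (Suc n) powr (- 1 - \<epsilon>)" for n
  proof -
    have "cmod (a (Suc n) * of_nat (Suc n) powr (- s)) \<le>
            C * real (Suc n) powr \<epsilon> * real (Suc n) powr (- Re s)"
      unfolding norm_mult using C
      by (intro mult_mono) (auto simp: norm_powr_real_powr simp del: of_nat_Suc)
    also have "\<dots> = C * real (Suc n) powr (- 1 - \<epsilon>)"
      by (simp add: powr_add [symmetric] \<epsilon>_def field_simps del: of_nat_Suc)
    finally show ?thesis .
  qed
  ultimately show ?thesis
    by (rule_tac summable_comparison_test' [where N = 0 and g = "\<lambda>n. C * real (Suc n) powr (- 1 - \<epsilon>)"])
       (simp_all only: real_norm_def abs_norm_cancel)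
qed

text \<open>Summation by parts: the partial sums differ from those of \<open>G_sums\<close> by
  \<open>a M * (M+1)^(-s)\<close>, which is \<open>O(M^(-\<epsilon>))\<close> for
  \<open>\<epsilon> = Re s / 2\<close>.\<close>

lemma abel_sums:
  assumes "Re s > 0"
  shows "(\<lambda>n. a (Suc n) * (of_nat (Suc n) powr (- s) - of_nat (Suc (Suc n)) powr (- s))) sums G s"
proof -
  define \<epsilon> where "\<epsilon> = Re s / 2"
  have \<epsilon>: "\<epsilon> > 0"
    using assms by (simp add: \<epsilon>_def)
  obtain C where C: "C \<ge> 0" "\<And>n. cmod (a n) \<le> C * real n powr \<epsilon>"
    using a_bound [OF \<epsilon>] by blast
  have partial: "(\<Sum>n<M. a (Suc n) * (of_nat (Suc n) powr (- s) - of_nat (Suc (Suc n)) powr (- s))) =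
      (\<Sum>n<M. (a (Suc n) - a n) * of_nat (Suc n) powr (- s)) - a M * of_nat (Suc M) powr (- s)" for M
    by (induction M) (auto simp: a_0 algebra_simps simp del: of_nat_Suc)
  have "(\<lambda>M. a M * of_nat (Suc M) powr (- s)) \<longlonglongrightarrow> 0"
  proof (rule Lim_null_comparison)
    show "\<forall>\<^sub>F M in sequentially. norm (a M * of_nat (Suc M) powr (- s)) \<le> C * real (Suc M) powr (- \<epsilon>)"
    proof (intro always_eventually allI)
      fix M
      have "cmod (a M) \<le> C * real M powr \<epsilon>"
        by (rule C)
      also have "\<dots> \<le> C * real (Suc M) powr \<epsilon>"
        using C \<epsilon> by (intro mult_left_mono powr_mono2) auto
      finally have "cmod (a M * of_nat (Suc M) powr (- s)) \<le>
              C * real (Suc M) powr \<epsilon> * real (Suc M) powr (- Re s)"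
        unfolding norm_mult using C
        by (intro mult_mono) (auto simp: norm_powr_real_powr simp del: of_nat_Suc)
      also have "\<dots> = C * real (Suc M) powr (- \<epsilon>)"
        by (simp add: powr_add [symmetric] \<epsilon>_def field_simps del: of_nat_Suc)
      finally show "norm (a M * of_nat (Suc M) powr (- s)) \<le> C * real (Suc M) powr (- \<epsilon>)" .
    qed
    have "(\<lambda>M. real (Suc M) powr (- \<epsilon>)) \<longlonglongrightarrow> 0"
      using \<epsilon> by (intro tendsto_neg_powr filterlim_compose [OF filterlim_real_sequentially filterlim_Suc]) auto
    thus "(\<lambda>M. C * real (Suc M) powr (- \<epsilon>)) \<longlonglongrightarrow> 0"
      by (rule tendsto_mult_right_zero)
  qed
  from tendsto_diff [OF G_sums [OF assms, unfolded sums_def] this] show ?thesis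
    unfolding sums_def partial by simp
qed

section \<open>The remainder series\<close>

definition remainder_series :: "nat \<Rightarrow> complex \<Rightarrow> complex" where
  "remainder_series N s = (\<Sum>n. a (Suc n) * euler_maclaurin_remainder N (Suc n) s)"

text \<open>Weierstrass' criterion: near each point the rising factorial is bounded by compactness,
  and the remaining power of \<open>n\<close> is summable even after the growth of \<open>a\<close>
  is charged.\<close>

lemma remainder_series:
  "(\<forall>s. Re s > - real N \<longrightarrow>
      (\<lambda>n. a (Suc n) * euler_maclaurin_remainder N (Suc n) s) sums remainder_series N s) \<and>
   remainder_series N holomorphic_on {s. Re s > - real N}"
proof -
  define S where "S = {s. Re s > - real N}"
  have S: "open S"
    unfolding S_def by (rule open_halfspace_Re_gt)
  obtain g where g: "\<forall>s\<in>S. (\<lambda>n. a (Suc n) * euler_maclaurin_remainder N (Suc n) s) sums g s \<and>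
                       g field_differentiable (at s)"
  proof (rule series_differentiable_comparison_complex [OF S])
    fix n s assume "s \<in> S"
    have "(\<lambda>s. a (Suc n) * euler_maclaurin_remainder N (Suc n) s) holomorphic_on UNIV"
      unfolding euler_maclaurin_remainder_def by (intro holomorphic_intros; simp)
    thus "(\<lambda>s. a (Suc n) * euler_maclaurin_remainder N (Suc n) s) field_differentiable at s"
      by (simp add: holomorphic_on_def)
  next
    fix s assume "s \<in> S"
    \<comment> \<open>Half the distance to the line \<open>Re z = - N\<close>, so
      \<open>Re z + N > \<delta>\<close> on the ball; the weights then use up
      \<open>\<delta> / 2\<close> of the decay.\<close>
    define \<delta> where "\<delta> = (Re s + real N) / 2"
    have \<delta>: "\<delta> > 0"
      using \<open>s \<in> S\<close> by (simp add: \<delta>_def S_def)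
    obtain C where C: "C \<ge> 0" "\<And>n. cmod (a n) \<le> C * real n powr (\<delta> / 2)"
      using a_bound [of "\<delta> / 2"] \<delta> by auto
    define B where "B = (\<Sum>j\<le>N. cmod (euler_maclaurin_coeff j))"
    have "compact ((\<lambda>z. pochhammer (z - 1) (N + 2)) ` cball s \<delta>)"
      by (intro compact_continuous_image continuous_intros) auto
    then obtain M where M: "M > 0" "\<And>z. z \<in> cball s \<delta> \<Longrightarrow> cmod (pochhammer (z - 1) (N + 2)) \<le> M"
      by (auto dest!: compact_imp_bounded simp: bounded_pos)
    have "B \<ge> 0"
      unfolding B_def by (intro sum_nonneg) auto
    define h where "h n = C * B * M * real (Suc n) powr (- 1 - \<delta> / 2)" for n
    have h: "h n \<ge> 0" for n
      using C M \<open>B \<ge> 0\<close> by (simp add: h_def)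
    have "summable (\<lambda>n. real n powr (- 1 - \<delta> / 2))"
      using \<delta> by (subst summable_real_powr_iff) auto
    hence "summable (\<lambda>n. real (Suc n) powr (- 1 - \<delta> / 2))"
      by (subst summable_Suc_iff)
    hence "summable h"
      unfolding h_def by (rule summable_mult)
    moreover have "cmod (a (Suc n) * euler_maclaurin_remainder N (Suc n) z) \<le> h n" if "z \<in> ball s \<delta>" for n z
    proof -
      have "\<bar>Re s - Re z\<bar> < \<delta>"
        using that abs_Re_le_cmod [of "s - z"] by (simp add: dist_norm)
      hence Re: "Re z > \<delta> - real N"
        by (auto simp: \<delta>_def abs_if field_simps split: if_splits)
      have "cmod (euler_maclaurin_remainder N (Suc n) z) \<le>
              B * cmod (pochhammer (z - 1) (N + 2)) * real (Suc n) powr (- Re z - real N - 1)"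
        unfolding B_def using Re \<delta> by (intro euler_maclaurin_remainder_bound) auto
      also have "\<dots> \<le> B * M * real (Suc n) powr (- 1 - \<delta>)"
        using Re that M \<open>B \<ge> 0\<close> by (intro mult_mono powr_mono) auto
      finally have "cmod (a (Suc n) * euler_maclaurin_remainder N (Suc n) z) \<le>
          (C * real (Suc n) powr (\<delta> / 2)) * (B * M * real (Suc n) powr (- 1 - \<delta>))"
        unfolding norm_mult using C by (intro mult_mono) (auto simp del: of_nat_Suc)
      also have "\<dots> = C * B * M * (real (Suc n) powr (\<delta> / 2) * real (Suc n) powr (- 1 - \<delta>))"
        by (simp only: mult_ac)
      also have "real (Suc n) powr (\<delta> / 2) * real (Suc n) powr (- 1 - \<delta>) = real (Suc n) powr (- 1 - \<delta> / 2)"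
        by (simp add: powr_add [symmetric] algebra_simps del: of_nat_Suc)
      also have "C * B * M * \<dots> = h n"
        by (simp add: h_def)
      finally show ?thesis .
    qed
    ultimately show "\<exists>d h. 0 < d \<and> summable h \<and> range h \<subseteq> \<real>\<^sub>\<ge>\<^sub>0 \<and>
        (\<forall>\<^sub>F n in sequentially. \<forall>y\<in>ball s d \<inter> S.
           cmod (a (Suc n) * euler_maclaurin_remainder N (Suc n) y) \<le> cmod (h n))"
      using \<delta> h
      by (intro exI [of _ \<delta>] exI [of _ "\<lambda>n. complex_of_real (h n)"] conjI always_eventually)
         (simp_all add: summable_of_real_iff complex_nonneg_Reals_iff image_subset_iff)
  qed
  have eq: "remainder_series N s = g s" if "s \<in> S" for s
    using g that by (auto simp: remainder_series_def sums_iff)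
  have "g holomorphic_on S"
    using g by (auto simp: holomorphic_on_def field_differentiable_at_within)
  hence "remainder_series N holomorphic_on S"
    using holomorphic_cong [OF refl eq] by simp
  thus ?thesis
    using g eq by (auto simp: S_def)
qed

lemmas remainder_series_sums = remainder_series [THEN conjunct1, rule_format]

lemma remainder_series_analytic:
  assumes "Re s > - real N"
  shows "remainder_series N analytic_on {s}"
proof -
  have "remainder_series N analytic_on {s. Re s > - real N}"
    using remainder_series by (simp add: analytic_on_open open_halfspace_Re_gt)
  thus ?thesis
    by (rule analytic_on_subset) (use assms in auto)
qed

text \<open>\<open>numer N s / (s - 1)\<close> continues the Dirichlet series of \<open>a\<close> to \<open>Re s > -N\<close>.\<close>
definition numer :: "nat \<Rightarrow> complex \<Rightarrow> complex" where
  "numer N s = (\<Sum>j\<le>N. euler_maclaurin_coeff j * pochhammer (s - 1) j * G (s - 1 + of_nat j)) +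
     remainder_series N s"

text \<open>For \<open>N = 0\<close> the subtracted differences sum to \<open>G (s - 1)\<close> by
  \<open>abel_sums\<close>, which cancels the single \<open>G\<close> term of
  \<open>numer\<close>.\<close>

lemma numer_0:
  assumes "Re s > 1"
  shows "numer 0 s = (s - 1) * (\<Sum>n. a (Suc n) * of_nat (Suc n) powr (- s))"
proof -
  have of_nat_Suc_0: "of_nat (Suc 0) = (1 :: complex)"
    by simp
  have "(\<lambda>n. (s - 1) * (a (Suc n) * of_nat (Suc n) powr (- s)) -
           a (Suc n) * (of_nat (Suc n) powr (- (s - 1)) - of_nat (Suc (Suc n)) powr (- (s - 1))))
        sums ((s - 1) * (\<Sum>n. a (Suc n) * of_nat (Suc n) powr (- s)) - G (s - 1))"
    using assms norm_summable [OF assms]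
    by (intro sums_diff sums_mult summable_sums abel_sums) (auto dest: summable_norm_cancel)
  moreover have "(\<lambda>n. a (Suc n) * euler_maclaurin_remainder 0 (Suc n) s) =
     (\<lambda>n. (s - 1) * (a (Suc n) * of_nat (Suc n) powr (- s)) -
           a (Suc n) * (of_nat (Suc n) powr (- (s - 1)) - of_nat (Suc (Suc n)) powr (- (s - 1))))"
    by (intro ext, simp only: euler_maclaurin_remainder_def)
       (simp add: euler_maclaurin_coeff_0 right_diff_distrib mult_ac of_nat_Suc_0 del: of_nat_Suc)
  ultimately show ?thesis
    by (simp add: numer_def remainder_series_def sums_iff euler_maclaurin_coeff_0 del: of_nat_Suc)
qed

text \<open>Passing to \<open>Suc N\<close> moves one term \<open>c * G w\<close> from the series
  into the finite sum. \<open>abel_sums\<close> applies at \<open>w = s + N\<close>, whose real part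
  is positive exactly when \<open>Re s > - N\<close>.\<close>

lemma numer_Suc:
  assumes "Re s > - real N"
  shows "numer (Suc N) s = numer N s"
proof -
  define c where "c = euler_maclaurin_coeff (Suc N) * pochhammer (s - 1) (Suc N)"
  define w where "w = s - 1 + of_nat (Suc N)"
  have "(\<lambda>n. a (Suc n) * euler_maclaurin_remainder N (Suc n) s -
          c * (a (Suc n) * (of_nat (Suc n) powr (- w) - of_nat (Suc (Suc n)) powr (- w))))
        sums (remainder_series N s - c * G w)"
    using assms by (intro sums_diff sums_mult abel_sums remainder_series_sums) (auto simp: w_def)
  also have "(\<lambda>n. a (Suc n) * euler_maclaurin_remainder N (Suc n) s -
          c * (a (Suc n) * (of_nat (Suc n) powr (- w) - of_nat (Suc (Suc n)) powr (- w)))) =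
        (\<lambda>n. a (Suc n) * euler_maclaurin_remainder (Suc N) (Suc n) s)"
    unfolding euler_maclaurin_remainder_Suc c_def w_def by (simp add: fun_eq_iff right_diff_distrib mult_ac)
  finally have "remainder_series (Suc N) s = remainder_series N s - c * G w"
    by (simp add: remainder_series_def sums_iff)
  thus ?thesis
    by (simp add: numer_def c_def w_def)
qed

lemma numer_mono:
  assumes "N \<le> M" "Re s > - real N"
  shows "numer M s = numer N s"
  using assms(1)
proof (induction M rule: dec_induct)
  case (step M)
  have "Re s > - real M"
    using assms(2) step.hyps by linarith
  thus ?case
    using step.IH by (simp add: numer_Suc)
qed simp

text \<open>The chosen \<open>N\<close> is merely one with \<open>Re s > - N\<close>; by
  \<open>numer_mono\<close> every other such \<open>N\<close> gives the same value, so the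
  half-plane formulas glue together.\<close>

definition continuation :: "complex \<Rightarrow> complex" where
  "continuation s = numer (nat \<lceil>- Re s\<rceil> + 1) s / (s - 1)"

lemma continuation_eq:
  assumes "Re s > - real N"
  shows "continuation s = numer N s / (s - 1)"
proof -
  define K where "K = nat \<lceil>- Re s\<rceil> + 1"
  have "Re s > - real K"
    unfolding K_def by linarith
  hence "numer K s = numer (max K N) s" "numer N s = numer (max K N) s"
    using assms by (auto intro!: numer_mono [symmetric])
  thus ?thesis
    by (simp add: continuation_def K_def)
qed

lemma eventually_continuation_eq:
  assumes "Re s > - real N"
  shows "\<forall>\<^sub>F z in nhds s. continuation z = numer N z / (z - 1)"
proof -
  have "\<forall>\<^sub>F z in nhds s. z \<in> {z. Re z > - real N}"
    using assms by (intro eventually_nhds_in_open open_halfspace_Re_gt) auto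
  thus ?thesis
    by eventually_elim (simp add: continuation_eq)
qed

lemma continuation_meromorphic: "continuation meromorphic_on UNIV"
proof (subst meromorphic_on_meromorphic_at, intro ballI)
  fix s :: complex
  define N where "N = nat \<lceil>- Re s\<rceil> + 1"
  have N: "Re s > - real N"
    unfolding N_def by linarith
  have "(\<lambda>z. G (z - 1 + of_nat j)) meromorphic_on {s}" for j
    by (rule meromorphic_on_compose [OF G_meromorphic]) (auto intro!: analytic_intros)
  moreover have "(\<lambda>z. pochhammer (z - 1) j) meromorphic_on {s}" for j
    by (intro analytic_on_imp_meromorphic_on pochhammer_analytic)
  ultimately have "(\<lambda>z. numer N z / (z - 1)) meromorphic_on {s}"
    unfolding numer_def
    using analytic_on_imp_meromorphic_on [OF remainder_series_analytic [OF N]]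
    by (intro meromorphic_intros)
  moreover have "\<forall>\<^sub>F z in at s. continuation z = numer N z / (z - 1)"
    using eventually_continuation_eq [OF N] by (simp add: eventually_nhds_conv_at)
  ultimately show "continuation meromorphic_on {s}"
    by (subst meromorphic_on_cong [where g = "\<lambda>z. numer N z / (z - 1)" and B = "{s}"]) auto
qed

text \<open>Restricting the condition on \<open>G\<close> to nonzero coefficients lets a vanishing
  Bernoulli number suppress a pole of \<open>G\<close>.\<close>

lemma continuation_analytic:
  assumes "Re s > - real N" "s \<noteq> 1"
    and G: "\<And>j. j \<le> N \<Longrightarrow> euler_maclaurin_coeff j \<noteq> 0 \<Longrightarrow> G analytic_on {s - 1 + of_nat j}"
  shows "continuation analytic_on {s}"
proof -
  have "(\<lambda>z. euler_maclaurin_coeff j * pochhammer (z - 1) j * G (z - 1 + of_nat j)) analytic_on {s}"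
    if "j \<le> N" for j
  proof (cases "euler_maclaurin_coeff j = 0")
    case False
    have "(G \<circ> (\<lambda>z. z - 1 + of_nat j)) analytic_on {s}"
      by (rule analytic_on_compose) (use G [OF that False] in \<open>auto intro!: analytic_intros\<close>)
    thus ?thesis
      by (auto intro!: analytic_intros pochhammer_analytic simp: o_def)
  qed auto
  hence "(\<lambda>z. numer N z / (z - 1)) analytic_on {s}"
    unfolding numer_def using assms(1,2) remainder_series_analytic [OF assms(1)]
    by (intro analytic_on_divide analytic_on_add analytic_on_sum analytic_on_diff
          analytic_on_ident analytic_on_const) auto
  thus ?thesis
    using eventually_continuation_eq [OF assms(1)] by (subst analytic_at_cong) auto
qed

lemma continuation_series:
  assumes "Re s > 1"
  shows "continuation s = (\<Sum>n. a (Suc n) * of_nat (Suc n) powr (- s))"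
proof -
  have "s \<noteq> 1"
    using assms by auto
  moreover have "continuation s = numer 0 s / (s - 1)"
    using assms by (intro continuation_eq) simp
  ultimately show ?thesis
    using numer_0 [OF assms] by simp
qed

lemma meromorphic_continuation_series:
  "meromorphic_continuation {s. Re s > 1} (\<lambda>s. \<Sum>n. a (Suc n) * of_nat (Suc n) powr (- s)) =
     remove_sings continuation"
  unfolding meromorphic_continuation_def
proof (rule the_equality)
  \<comment> \<open>Analyticity ensures that \<open>remove_sings\<close> keeps the values on the
    half-plane; for \<open>N = 0\<close> only \<open>G (s - 1)\<close> occurs.\<close>
  have "continuation analytic_on {s}" if "Re s > 1" for s
    using that
    by (intro continuation_analytic [where N = 0]) (auto intro: analytic_on_subset [OF G_analytic])
  thus *: "remove_sings continuation nicely_meromorphic_on UNIV \<and>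
        (\<forall>s\<in>{s. Re s > 1}. remove_sings continuation s = (\<Sum>n. a (Suc n) * of_nat (Suc n) powr (- s)))"
    by (auto intro!: remove_sings_nicely_meromorphic continuation_meromorphic simp: continuation_series)
  fix g assume "g nicely_meromorphic_on UNIV \<and>
        (\<forall>s\<in>{s. Re s > 1}. g s = (\<Sum>n. a (Suc n) * of_nat (Suc n) powr (- s)))"
  thus "g = remove_sings continuation"
  proof (elim conjE, intro meromorphic_continuation_unique [of g _ "{s. Re s > 1}"])
    have "(2 :: complex) \<in> {s. Re s > 1}"
      by simp
    thus "{s :: complex. Re s > 1} \<noteq> {}"
      by blast
  qed (use * in \<open>auto simp: open_halfspace_Re_gt\<close>)
qed

section \<open>Values at the nonpositive integers\<close>

lemma numer_neg:
  assumes "k < N"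
  shows "numer N (- of_nat k) =
    (\<Sum>j\<le>N. euler_maclaurin_coeff j * pochhammer (- of_nat (Suc k)) j * G (of_nat j - of_nat (Suc k)))"
proof -
  have "- of_nat k - 1 = - (of_nat (Suc k) :: complex)"
    and "- of_nat (Suc k) + of_nat j = (of_nat j - of_nat (Suc k) :: complex)" for j
    by simp_all
  thus ?thesis
    using assms unfolding numer_def remainder_series_def
    by (simp add: euler_maclaurin_remainder_eq_0 del: of_nat_Suc)
qed

text \<open>Taking \<open>N = Suc k\<close> kills the remainder, and the denominator
  \<open>s - 1 = - (k + 1)\<close> reduces \<open>(k + 1)!\<close> to \<open>- k!\<close>. This is a
  pointwise identity: the last summand contains whatever value \<open>G 0\<close> has, even at a
  pole.\<close>

lemma continuation_neg:
  "continuation (- of_nat k) =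
     - fact k * (\<Sum>j\<le>Suc k. of_real (bernoulli j / (fact j * fact (Suc k - j))) * G (of_nat j - of_nat (Suc k)))"
proof -
  have "continuation (- of_nat k) = numer (Suc k) (- of_nat k) / (- of_nat (Suc k))"
    by (subst continuation_eq [where N = "Suc k"]) auto
  also have "numer (Suc k) (- of_nat k) = fact (Suc k) *
      (\<Sum>j\<le>Suc k. of_real (bernoulli j / (fact j * fact (Suc k - j))) * G (of_nat j - of_nat (Suc k)))"
    unfolding numer_neg [OF lessI] sum_distrib_left
    by (intro sum.cong refl, subst euler_maclaurin_coeff_pochhammer) (auto simp: mult_ac)
  finally show ?thesis
    by (simp add: field_simps del: of_nat_Suc sum.atMost_Suc)
qed

end

section \<open>The zeta function and the harmonic zeta function\<close>

interpretation zeta: dirichlet_abel "\<lambda>n. if n = 0 then 0 else 1" "\<lambda>_. 1"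
proof
  fix \<epsilon> :: real assume "\<epsilon> > 0"
  hence "1 \<le> real n powr \<epsilon>" if "n > 0" for n
    using that by (intro ge_one_powr_ge_zero) auto
  thus "\<exists>C\<ge>0. \<forall>n. cmod (if n = 0 then 0 else 1) \<le> C * real n powr \<epsilon>"
    by (intro exI [of _ 1]) auto
next
  fix s :: complex
  \<comment> \<open>Only the jump from \<open>a 0\<close> to \<open>a 1\<close> is nonzero, and it
    contributes \<open>1 powr (- s) = 1\<close>.\<close>
  show "(\<lambda>n. ((if Suc n = 0 then 0 else 1) - (if n = 0 then 0 else 1)) * of_nat (Suc n) powr (- s)) sums 1"
    using sums_finite [of "{0}" "\<lambda>n. ((if Suc n = 0 then 0 else 1) - (if n = 0 then 0 else 1)) * of_nat (Suc n) powr (- s)"]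
    by simp
qed auto

lemma riemann_zeta_eq_remove_sings: "riemann_zeta = remove_sings zeta.continuation"
  using zeta.meromorphic_continuation_series by (simp add: riemann_zeta_def)

lemma zeta_continuation_analytic: "s \<noteq> 1 \<Longrightarrow> zeta.continuation analytic_on {s}"
  by (rule zeta.continuation_analytic [where N = "nat \<lceil>- Re s\<rceil> + 1"]) (auto, linarith)

lemma riemann_zeta_eq: "s \<noteq> 1 \<Longrightarrow> riemann_zeta s = zeta.continuation s"
  by (simp add: riemann_zeta_eq_remove_sings zeta_continuation_analytic)

lemma riemann_zeta_analytic:
  assumes "s \<noteq> 1"
  shows "riemann_zeta analytic_on {s}"
proof -
  have "\<forall>\<^sub>F z in nhds s. z \<noteq> 1"
    using assms by (intro t1_space_nhds)
  hence "\<forall>\<^sub>F z in nhds s. riemann_zeta z = zeta.continuation z"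
    by (auto elim!: eventually_mono simp: riemann_zeta_eq)
  thus ?thesis
    using zeta_continuation_analytic [OF assms] by (subst analytic_at_cong) auto
qed

lemma riemann_zeta_series:
  assumes "Re s > 1"
  shows "(\<lambda>n. of_nat (Suc n) powr (- s)) sums riemann_zeta s"
proof -
  have "summable (\<lambda>n. of_nat (Suc n) powr (- s) :: complex)"
    using zeta.norm_summable [OF assms] by (auto dest: summable_norm_cancel)
  moreover have "riemann_zeta s = (\<Sum>n. of_nat (Suc n) powr (- s))"
    using assms zeta.continuation_series [OF assms] riemann_zeta_eq [of s] by fastforce
  ultimately show ?thesis
    by (simp add: sums_iff)
qed

text \<open>With \<open>G = 1\<close> the finite sum is the Bernoulli recursion plus its missing top
  term; the exceptional case \<open>k = 0\<close> is the nonzero case of the recursion.\<close>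

lemma riemann_zeta_neg:
  "riemann_zeta (- of_nat k) = - of_real (bernoulli (Suc k) + (if k = 0 then 1 else 0)) / of_nat (Suc k)"
proof -
  have "riemann_zeta (- of_nat k) = zeta.continuation (- of_nat k)"
  proof (rule riemann_zeta_eq)
    have "Re (- of_nat k) \<noteq> Re 1"
      by simp
    thus "- of_nat k \<noteq> (1 :: complex)"
      by metis
  qed
  also have "\<dots> = - fact k * of_real (\<Sum>j\<le>Suc k. bernoulli j / (fact j * fact (Suc k - j)))"
    unfolding zeta.continuation_neg by simp
  also have "(\<Sum>j\<le>Suc k. bernoulli j / (fact j * fact (Suc k - j))) =
      (if k = 0 then 1 else 0) + bernoulli (Suc k) / fact (Suc k)"
    using sum_bernoulli_eq [of "Suc k"] by (simp add: lessThan_Suc_atMost)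
  finally have eq: "riemann_zeta (- of_nat k) =
      - fact k * of_real ((if k = 0 then 1 else 0) + bernoulli (Suc k) / fact (Suc k))" .
  have "(fact k :: complex) * of_real ((if k = 0 then 1 else 0) + bernoulli (Suc k) / fact (Suc k)) =
      of_real (bernoulli (Suc k) + (if k = 0 then 1 else 0)) / of_nat (Suc k)"
    by (cases "k = 0") (simp_all add: add.commute)
  thus ?thesis
    unfolding eq by (simp only: mult_minus_left minus_divide_left)
qed

section \<open>The harmonic weights\<close>

lemma harm_le_powr:
  assumes "\<epsilon> > 0"
  shows "harm n \<le> (1 + 1 / \<epsilon>) * real n powr \<epsilon>"
proof (cases n)
  case (Suc m)
  \<comment> \<open>Monotonicity of \<open>harm n - ln n\<close> gives
    \<open>harm n \<le> 1 + ln n\<close>; both summands are then compared with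
    \<open>n powr \<epsilon>\<close>.\<close>
  have "harm (Suc m) - ln (Suc m) \<le> harm (Suc 0) - ln (Suc 0)"
    using decseqD [OF decseq_harm_diff_ln, of 0 m] by simp
  moreover have "ln (real n) \<le> real n powr \<epsilon> / \<epsilon>"
    using Suc assms by (intro ln_powr_bound) auto
  moreover have "1 \<le> real n powr \<epsilon>"
    using Suc assms by (intro ge_one_powr_ge_zero) auto
  ultimately show ?thesis
    using Suc by (simp add: harm_def algebra_simps)
qed (simp add: harm_def)

interpretation harmonic: dirichlet_abel harm "\<lambda>s. riemann_zeta (s + 1)"
proof
  show "harm 0 = (0 :: complex)"
    by (simp add: harm_def)
next
  fix \<epsilon> :: real assume "\<epsilon> > 0"
  moreover have "cmod (harm n) = harm n" for n
  proof -
    have "cmod (harm n) = cmod (of_real (harm n))"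
      by (simp add: of_real_harm)
    thus ?thesis
      by (simp add: harm_nonneg)
  qed
  ultimately show "\<exists>C\<ge>0. \<forall>n. cmod (harm n) \<le> C * real n powr \<epsilon>"
    using harm_le_powr by (intro exI [of _ "1 + 1 / \<epsilon>"]) auto
next
  fix s :: complex assume "Re s > 0"
  hence "(\<lambda>n. of_nat (Suc n) powr (- (s + 1))) sums riemann_zeta (s + 1)"
    by (intro riemann_zeta_series) auto
  \<comment> \<open>The jump of \<open>harm\<close> at \<open>Suc n\<close> is
    \<open>1 / Suc n\<close>, which shifts the exponent by one.\<close>
  also have "(\<lambda>n. of_nat (Suc n) powr (- (s + 1))) =
      (\<lambda>n. (harm (Suc n) - harm n) * of_nat (Suc n) powr (- s) :: complex)"
    by (simp add: fun_eq_iff harm_Suc powr_diff powr_minus field_simps del: of_nat_Suc)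
  finally show "(\<lambda>n. (harm (Suc n) - harm n) * of_nat (Suc n) powr (- s)) sums riemann_zeta (s + 1)" .
next
  have "(riemann_zeta \<circ> (\<lambda>s. s + 1)) analytic_on {s}" if "Re s > 0" for s
    using that by (intro analytic_on_compose) (auto intro!: analytic_intros riemann_zeta_analytic)
  thus "(\<lambda>s. riemann_zeta (s + 1)) analytic_on {s. Re s > 0}"
    by (subst analytic_on_analytic_at) (auto simp: o_def)
next
  have "riemann_zeta meromorphic_on UNIV"
    unfolding riemann_zeta_eq_remove_sings
    using remove_sings_nicely_meromorphic [OF zeta.continuation_meromorphic]
    by (simp add: nicely_meromorphic_on_def)
  thus "(\<lambda>s. riemann_zeta (s + 1)) meromorphic_on UNIV"
    by (rule meromorphic_on_compose) (auto intro!: analytic_intros)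
qed

section \<open>Values at the negative even integers\<close>

lemma harmonic_zeta_neg_even:
  assumes "m > 0"
  shows "harmonic_zeta (- of_nat (2 * m)) = harmonic.continuation (- of_nat (2 * m))"
proof -
  \<comment> \<open>\<open>harmonic_zeta\<close> is \<open>remove_sings\<close> of the continuation,
    so the pointwise value carries over once the continuation is analytic at this point.\<close>
  have "harmonic.continuation analytic_on {- of_nat (2 * m)}"
  proof (rule harmonic.continuation_analytic [where N = "2 * m + 1"])
    have "Re (- of_nat (2 * m)) \<noteq> Re 1"
      by (simp add: assms)
    thus "- of_nat (2 * m) \<noteq> (1 :: complex)"
      by metis
    fix j assume "j \<le> 2 * m + 1" and j: "euler_maclaurin_coeff j \<noteq> 0"
    \<comment> \<open>This is the only \<open>j\<close> for which \<open>riemann_zeta\<close> would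
      be taken at its pole 1; its coefficient vanishes because \<open>2 * m + 1\<close> is odd and
      at least 3.\<close>
    have "j \<noteq> 2 * m + 1"
      using j assms by (auto simp: euler_maclaurin_coeff_def bernoulli_plus_def bernoulli_odd)
    hence "(of_nat j :: complex) \<noteq> of_nat (2 * m + 1)"
      by (simp only: of_nat_eq_iff simp_thms)
    hence "- of_nat (2 * m) - 1 + of_nat j + 1 \<noteq> (1 :: complex)"
      by (simp add: algebra_simps)
    hence "(riemann_zeta \<circ> (\<lambda>s. s + 1)) analytic_on {- of_nat (2 * m) - 1 + of_nat j}"
      by (intro analytic_on_compose) (auto intro!: analytic_intros riemann_zeta_analytic)
    thus "(\<lambda>s. riemann_zeta (s + 1)) analytic_on {- of_nat (2 * m) - 1 + of_nat j}"
      by (simp add: o_def)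
  qed auto
  thus ?thesis
    using harmonic.meromorphic_continuation_series by (simp add: harmonic_zeta_def)
qed

theorem corollary1:
  fixes m :: nat
  assumes "m > 0"
  shows "complex_of_real (fact (2 * m) * bernoulli_conv (2 * m + 1)) =
           harmonic_zeta (- 2 * of_nat m) - riemann_zeta (1 - 2 * of_nat m) \<and>
         harmonic_zeta (- 2 * of_nat m) - riemann_zeta (1 - 2 * of_nat m) =
           complex_of_real (1 / 2 * bernoulli (2 * m) * (1 + 1 / (2 * real m)))"
proof -
  define t where "t j = of_real (bernoulli j / (fact j * fact (Suc (2 * m) - j))) *
    riemann_zeta (of_nat j - of_nat (Suc (2 * m)) + 1)" for j
  have zeta: "riemann_zeta (of_nat j - of_nat (Suc (2 * m)) + 1) =
      - of_real (bernoulli (Suc (2 * m - j)) + (if 2 * m - j = 0 then 1 else 0)) / of_nat (Suc (2 * m - j))"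
    if "j \<le> 2 * m" for j
  proof -
    have "of_nat j - of_nat (Suc (2 * m)) + 1 = - (of_nat (2 * m - j) :: complex)"
      using that by (simp add: of_nat_diff)
    thus ?thesis
      by (simp only: riemann_zeta_neg)
  qed
  have zeta1: "riemann_zeta (1 - 2 * of_nat m) = - of_real (bernoulli (2 * m)) / (2 * of_nat m)"
    using zeta [of 1] assms by (simp add: Suc_diff_le)
  \<comment> \<open>For even \<open>j < 2 * m\<close> the zeta factor is at a negative even integer
    and vanishes. For odd \<open>j \<ge> 3\<close> the Bernoulli number vanishes; this covers
    \<open>j = 2 * m + 1\<close>, whatever the value of \<open>riemann_zeta\<close> at 1.\<close>
  have "t j = 0" if "j \<in> {..Suc (2 * m)} - {1, 2 * m}" for j
  proof (cases "even j")
    case True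
    hence "j < 2 * m" "even (2 * m - j)"
      using that by (auto simp: le_Suc_eq)
    thus ?thesis
      using that unfolding t_def by (subst zeta) (auto simp: bernoulli_odd)
  next
    case False
    thus ?thesis
      using that by (simp add: t_def bernoulli_odd)
  qed
  hence "(\<Sum>j\<le>Suc (2 * m). t j) = (\<Sum>j\<in>{1, 2 * m}. t j)"
    using assms by (intro sum.mono_neutral_right) auto
  also have "\<dots> = t 1 + t (2 * m)"
    by simp
  also have "t 1 = - riemann_zeta (1 - 2 * of_nat m) / (2 * fact (2 * m))"
    by (simp add: t_def bernoulli_1)
  \<comment> \<open>Here the zeta argument is 0, with value \<open>- 1 / 2\<close>.\<close>
  also have "t (2 * m) = - of_real (bernoulli (2 * m)) / (2 * fact (2 * m))"
    using riemann_zeta_neg [of 0] by (simp add: t_def bernoulli_1)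
  finally have sum_t: "(\<Sum>j\<le>Suc (2 * m). t j) =
      - (riemann_zeta (1 - 2 * of_nat m) + of_real (bernoulli (2 * m))) / (2 * fact (2 * m))"
    by (simp add: field_simps)
  have "harmonic_zeta (- 2 * of_nat m) = harmonic.continuation (- of_nat (2 * m))"
    using harmonic_zeta_neg_even [OF assms] by simp
  also have "\<dots> = - fact (2 * m) * (\<Sum>j\<le>Suc (2 * m). t j)"
    unfolding harmonic.continuation_neg t_def ..
  also have "\<dots> = (riemann_zeta (1 - 2 * of_nat m) + of_real (bernoulli (2 * m))) / 2"
    unfolding sum_t by (simp add: field_simps)
  finally have h: "harmonic_zeta (- 2 * of_nat m) =
      (riemann_zeta (1 - 2 * of_nat m) + of_real (bernoulli (2 * m))) / 2" .
  \<comment> \<open>By \<open>h\<close> the difference is half of \<open>B_(2m)\<close> minus the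
    zeta value; inserting \<open>zeta1\<close> gives the closed form, which
    \<open>bernoulli_conv_odd\<close> also yields for the convolution.\<close>
  have "harmonic_zeta (- 2 * of_nat m) - riemann_zeta (1 - 2 * of_nat m) =
           complex_of_real (1 / 2 * bernoulli (2 * m) * (1 + 1 / (2 * real m)))"
    unfolding h zeta1 using assms by (simp add: field_simps)
  thus ?thesis
    by (simp only: bernoulli_conv_odd [OF assms] simp_thms)
qed

end
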